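(* Let $a,d\in\mathbb{N}$, let $n\in\mathbb{M}_{2a,d}$, and let $r\in\mathbb{Z}$. The circle of partition $\mathcal{C}(n,\mathbb{M}_{a,d})$ remains invariant under the $r$-th level rotation $\varpi_r$, i.e. $\mathcal{C}^r(n,\mathbb{M}_{a,d})=\mathcal{C}(n,\mathbb{M}_{a,d})$, provided that $d=2a$ and $r\equiv 0\pmod d$.
   Context: $\mathbb{N}$ is the set of positive integers. For $a,d\in\mathbb{N}$, $\mathbb{M}_{a,d}=\{x\in\mathbb{N}: x\equiv a\pmod d\}$. For $\mathbb{M}\subseteq\mathbb{N}$ and $n\in\mathbb{N}$, the circle of partition (CoP) is $\mathcal{C}(n,\mathbb{M})=\{[x]: x,y\in\mathbb{M},\ x+y=n\}$; points $[x]$ are identified by their weight $x$. For $r\in\mathbb{Z}$, the $r$-th level rotation is the map $\varpi_r:\mathcal{C}(n,\mathbb{M})\to\mathcal{C}^r(n,\mathbb{M})$, where $\mathcal{C}^r(n,\mathbb{M})$ is the set of points $[k]\in\mathcal{C}(n,\mathbb{M})$ such that, for some $[x]\in\mathcal{C}(n,\mathbb{M})$, $k$ is the residue of $x+r$ modulo $n$ if $x+r\not\equiv 0\pmod n$, and $k$ is the residue of $n+r$ modulo $n$ if $x+r\equiv 0\pmod n$ (residues taken in $\{0,1,\dots,n-1\}$). *)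

theory Defs
  imports "HOL-Number_Theory.Cong"
begin

definition residue_naturals :: "nat \<Rightarrow> nat \<Rightarrow> nat set" where
  "residue_naturals a d = {x. 0 < x \<and> [x = a] (mod d)}"

(* A point [x] is identified with its weight x. *)
definition CoP :: "nat \<Rightarrow> nat set \<Rightarrow> nat set" where
  "CoP n M = {x. \<exists>y. x \<in> M \<and> y \<in> M \<and> x + y = n}"

(* The rule of the r-th level rotation on weights. On a particular CoP its value need not be
   (the weight of) a point again, so it is a map on integers and not from the CoP to itself. *)
definition level_rotation :: "int \<Rightarrow> nat \<Rightarrow> int \<Rightarrow> int" where
  "level_rotation r n x =
     (if [x + r = 0] (mod int n) then (int n + r) mod int n else (x + r) mod int n)"

definition rotated_CoP :: "int \<Rightarrow> nat \<Rightarrow> nat set \<Rightarrow> nat set" where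
  "rotated_CoP r n M = {k \<in> CoP n M. \<exists>x \<in> CoP n M. int k = level_rotation r n (int x)}"

end

theory Submission
  imports Defs
begin

text \<open>
  If \<open>d = 2 * a\<close>, then \<open>d\<close> divides \<open>n\<close>, and \<open>a\<close> and \<open>-a\<close> are the same nonzero class modulo \<open>d\<close>.
  Hence the partner \<open>n - x\<close> of a weight \<open>x\<close> in the class of \<open>a\<close> again lies in that class, and the
  circle of partition is the whole class of \<open>a\<close> inside \<open>{0..<n}\<close> (lemma \<open>CoP_residue_naturals\<close>).
  Translation by a multiple \<open>r\<close> of \<open>d\<close>, followed by reduction modulo the multiple \<open>n\<close> of \<open>d\<close>,
  permutes this class, with inverse the translation by \<open>-r\<close>. The exceptional branch of the rotation
  rule never applies, since \<open>n\<close>, and so \<open>d\<close>, would divide a number congruent to \<open>a\<close>.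
\<close>

text \<open>The hypothesis \<open>d dvd 2 * a\<close> says that the class of \<open>a\<close> is its own negative, which pairs
  \<open>x\<close> with \<open>n - x\<close>; \<open>\<not> d dvd a\<close> keeps \<open>0\<close> (and with it \<open>n\<close>) out of the class.\<close>

lemma CoP_residue_naturals:
  fixes a d n :: nat
  assumes dn: "d dvd n" and d2a: "d dvd 2 * a" and da: "\<not> d dvd a"
  shows "CoP n (residue_naturals a d) = {x. x < n \<and> [x = a] (mod d)}"
proof (intro set_eqI iffI)
  fix x assume "x \<in> CoP n (residue_naturals a d)"
  then show "x \<in> {x. x < n \<and> [x = a] (mod d)}"
    by (auto simp: CoP_def residue_naturals_def)
next
  fix x assume "x \<in> {x. x < n \<and> [x = a] (mod d)}"
  then have xn: "x < n" and xa: "[x = a] (mod d)" by auto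
  have "x \<noteq> 0"
    using xa da by (metis cong_0_iff cong_sym)
  have "[x + (n - x) = a + a] (mod d)"
    using dn d2a xn by (simp add: cong_def flip: mult_2)
  then have "[a + (n - x) = a + a] (mod d)"
    using cong_add[OF xa cong_refl] cong_sym cong_trans by blast
  then have "[n - x = a] (mod d)"
    by (simp add: cong_add_lcancel_nat)
  with xn xa \<open>x \<noteq> 0\<close> show "x \<in> CoP n (residue_naturals a d)"
    by (auto simp: CoP_def residue_naturals_def intro!: exI[of _ "n - x"])
qed

lemma level_rotation_eq_mod:
  fixes d x r :: int
  assumes "d dvd int n" and "d dvd r" and "\<not> d dvd x"
  shows "level_rotation r n x = (x + r) mod int n"
proof -
  have "\<not> int n dvd x + r"
    using assms by (metis dvd_add_left_iff dvd_trans)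
  then show ?thesis
    by (simp add: level_rotation_def cong_0_iff)
qed

theorem proposition2p26:
  fixes a d n :: nat and r :: int
  assumes "a > 0" and "d > 0"
    and "n \<in> residue_naturals (2 * a) d"
    and "d = 2 * a" and "[r = 0] (mod int d)"
  shows "rotated_CoP r n (residue_naturals a d) = CoP n (residue_naturals a d)"
proof -
  have n0: "n > 0" and dn: "d dvd n"
    using assms(3,4) by (auto simp: residue_naturals_def cong_def)
  have dr: "int d dvd r"
    using assms(5) by (simp add: cong_0_iff)
  have d2a: "d dvd 2 * a" and da: "\<not> d dvd a"
    using assms(1,4) by (auto dest: dvd_imp_le)
  note CoP_eq = CoP_residue_naturals[OF dn d2a da]
  have "\<exists>x \<in> CoP n (residue_naturals a d). int k = level_rotation r n (int x)"
    if "k \<in> CoP n (residue_naturals a d)" for k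
  proof -
    from that have kn: "k < n" and ka: "[k = a] (mod d)"
      by (auto simp: CoP_eq)
    define x where "x = nat ((int k - r) mod int n)"
    have x: "int x = (int k - r) mod int n"
      using n0 by (simp add: x_def)
    have "[int x = int k - r] (mod int d)"
      using dn by (simp add: x cong_def mod_mod_cancel)
    also have "[int k - r = int a - 0] (mod int d)"
      using ka assms(5) by (intro cong_diff) (simp_all add: cong_int_iff)
    finally have xa: "[x = a] (mod d)"
      by (simp add: cong_int_iff)
    have "int x < int n"
      using n0 by (simp add: x)
    with xa have mem: "x \<in> CoP n (residue_naturals a d)"
      by (simp add: CoP_eq)
    have "\<not> int d dvd int x"
      using cong_dvd_iff[OF xa] xa da by (metis cong_0_iff cong_sym cong_trans int_dvd_int_iff)
    then have "level_rotation r n (int x) = (int x + r) mod int n"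
      using dn dr by (intro level_rotation_eq_mod[of "int d"]) simp_all
    also have "\<dots> = int k"
      using kn by (simp add: x mod_add_left_eq)
    finally show ?thesis
      using mem by force
  qed
  then show ?thesis
    by (auto simp: rotated_CoP_def)
qed

end
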